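(* Let $k$ be a field of characteristic different from $2$ and $3$, let $a,d\in k$ be distinct and non-zero, and let $n\ge1$ be an integer. Put $m(n)=\frac{n^2-1}{2}$ if $n$ is odd and $m(n)=\frac{n^2-2}{2}$ if $n$ is even. For the polynomial $\tilde\psi_n(y)\in k[y]$: if $4\nmid n$, then $\deg(\tilde\psi_n(y))=m(n)$; if $4\mid n$ and $\mathrm{char}(k)\nmid n$, then $\deg(\tilde\psi_n(y))=m(n)-1$; otherwise $\deg(\tilde\psi_n(y))<m(n)-1$.
   Context: When $\mathrm{char}(k)=0$, the condition $\mathrm{char}(k)\nmid n$ holds for every $n\ge1$. The $\tilde\psi_n=\tilde\psi_n(y)$ are defined recursively in the field of rational functions in $y$ over $k$ (each is in fact a polynomial in $y$) by $\tilde\psi_0=0$, $\tilde\psi_1=1$, $\tilde\psi_2=y+1$, $\tilde\psi_3=-dy^4-2dy^3+2ay+a$, $\tilde\psi_4=-2y(y+1)(dy^4-a)$, $$\tilde\psi_{2r+1}=\begin{cases}\dfrac{4(a-d)(a-dy^2)^2\tilde\psi_{r+2}\tilde\psi_r^3}{(y+1)^2}-\tilde\psi_{r-1}\tilde\psi_{r+1}^3 & r\equiv0\pmod 4,\ r\ge4,\\[2mm] \tilde\psi_{r+2}\tilde\psi_r^3-\dfrac{4(a-dy^2)^2\tilde\psi_{r-1}\tilde\psi_{r+1}^3}{(y+1)^2} & r\equiv1\pmod 4,\ r\ge5,\\[2mm] \dfrac{4(a-dy^2)^2\tilde\psi_{r+2}\tilde\psi_r^3}{(y+1)^2}-\tilde\psi_{r-1}\tilde\psi_{r+1}^3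 & r\equiv2\pmod 4,\ r\ge2,\\[2mm] \tilde\psi_{r+2}\tilde\psi_r^3-\dfrac{4(a-d)(a-dy^2)^2\tilde\psi_{r-1}\tilde\psi_{r+1}^3}{(y+1)^2} & r\equiv3\pmod 4,\ r\ge3,\end{cases}$$ $$\tilde\psi_{2r}=\begin{cases}\dfrac{\tilde\psi_r}{y+1}\left(\tilde\psi_{r+2}\tilde\psi_{r-1}^2-\tilde\psi_{r-2}\tilde\psi_{r+1}^2\right) & r\equiv0,2\pmod 4,\ r\ge4,\\[2mm] \dfrac{\tilde\psi_r}{y+1}\left((a-d)\tilde\psi_{r+2}\tilde\psi_{r-1}^2-\tilde\psi_{r-2}\tilde\psi_{r+1}^2\right) & r\equiv1\pmod 4,\ r\ge5,\\[2mm] \dfrac{\tilde\psi_r}{y+1}\left(\tilde\psi_{r+2}\tilde\psi_{r-1}^2-(a-d)\tilde\psi_{r-2}\tilde\psi_{r+1}^2\right) & r\equiv3\pmod 4,\ r\ge3.\end{cases}$$ *)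

theory Defs
  imports "HOL-Computational_Algebra.Computational_Algebra"
begin

definition const_fract :: "'a::field \<Rightarrow> 'a poly fract" where
  "const_fract c = to_fract [:c:]"

definition y_fract :: "'a::field poly fract" where
  "y_fract = to_fract [:0, 1:]"

(* The recursion takes place in the field of rational functions k(y).
   For n >= 5 it is driven by r = n div 2, that is, n = 2r or n = 2r + 1; then r >= 2,
   and every index occurring on the right-hand side is smaller than n. *)
function psi_tilde :: "'a::field \<Rightarrow> 'a \<Rightarrow> nat \<Rightarrow> 'a poly fract" where
  "psi_tilde a d n =
    (let y = y_fract; A = const_fract a; D = const_fract d; r = n div 2 in
     if n = 0 then 0
     else if n = 1 then 1
     else if n = 2 then y + 1
     else if n = 3 then - D * y^4 - 2 * D * y^3 + 2 * A * y + A
     else if n = 4 then - 2 * y * (y + 1) * (D * y^4 - A)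
     else if odd n then
       (if r mod 4 = 0 then
          4 * (A - D) * (A - D * y^2)^2 * psi_tilde a d (r + 2) * psi_tilde a d r ^ 3 / (y + 1)^2
            - psi_tilde a d (r - 1) * psi_tilde a d (r + 1) ^ 3
        else if r mod 4 = 1 then
          psi_tilde a d (r + 2) * psi_tilde a d r ^ 3
            - 4 * (A - D * y^2)^2 * psi_tilde a d (r - 1) * psi_tilde a d (r + 1) ^ 3 / (y + 1)^2
        else if r mod 4 = 2 then
          4 * (A - D * y^2)^2 * psi_tilde a d (r + 2) * psi_tilde a d r ^ 3 / (y + 1)^2
            - psi_tilde a d (r - 1) * psi_tilde a d (r + 1) ^ 3
        else
          psi_tilde a d (r + 2) * psi_tilde a d r ^ 3
            - 4 * (A - D) * (A - D * y^2)^2 * psi_tilde a d (r - 1) * psi_tilde a d (r + 1) ^ 3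
                / (y + 1)^2)
     else
       (if r mod 4 = 0 \<or> r mod 4 = 2 then
          psi_tilde a d r / (y + 1) *
            (psi_tilde a d (r + 2) * psi_tilde a d (r - 1) ^ 2
              - psi_tilde a d (r - 2) * psi_tilde a d (r + 1) ^ 2)
        else if r mod 4 = 1 then
          psi_tilde a d r / (y + 1) *
            ((A - D) * psi_tilde a d (r + 2) * psi_tilde a d (r - 1) ^ 2
              - psi_tilde a d (r - 2) * psi_tilde a d (r + 1) ^ 2)
        else
          psi_tilde a d r / (y + 1) *
            (psi_tilde a d (r + 2) * psi_tilde a d (r - 1) ^ 2
              - (A - D) * psi_tilde a d (r - 2) * psi_tilde a d (r + 1) ^ 2)))"
  by pat_completeness auto
termination
  by (relation "measure (\<lambda>(_, _, n). n)") auto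

declare psi_tilde.simps [simp del]

(* For n >= 1 the subtraction does not truncate and the division is exact. *)
definition m_deg :: "nat \<Rightarrow> nat" where
  "m_deg n = (if odd n then (n^2 - 1) div 2 else (n^2 - 2) div 2)"

end

theory Submission
  imports Defs
begin

text \<open>
  For even \<open>n\<close> the factor \<open>y + 1\<close> divides \<open>\<psi>\<^sub>n\<close>. Write
  \<open>\<psi>\<^sub>n = \<phi>\<^sub>n\<close> for odd \<open>n\<close> and \<open>\<psi>\<^sub>n = (y + 1) \<phi>\<^sub>n\<close> for even \<open>n\<close>.
  Every product in the recursion that is divided by \<open>(y + 1)\<^sup>2\<close> contains the cube of a term of
  even index, and in the formula for \<open>\<psi>\<^sub>2\<^sub>r\<close> either the outside factor and one factor of
  each product, or a squared factor of each product, has even index. So all denominators cancel,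
  and the \<open>\<phi>\<^sub>n\<close> satisfy a recursion over polynomials (\<open>psi_tilde_eq_phi\<close>).

  The degree is then found by computing one coefficient of \<open>\<phi>\<^sub>n\<close> exactly. Let
  \<open>e(n)\<close> be \<open>(n\<^sup>2 - 1) / 2\<close> for odd \<open>n\<close>, \<open>(n\<^sup>2 - 4) / 2\<close> for
  \<open>n\<close> congruent to 2 modulo 4, and \<open>(n\<^sup>2 - 6) / 2\<close> when 4 divides \<open>n\<close>. By
  induction \<open>\<phi>\<^sub>n\<close> has degree at most \<open>e(n)\<close>, and its coefficient at \<open>e(n)\<close>
  is, up to sign, a power of \<open>d\<close>, with an additional factor \<open>n / 2\<close> when 4 divides
  \<open>n\<close> (\<open>phi_top_term\<close>). The induction closes because a term whose index is divisible by 4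
  loses one degree, so that for an index not divisible by 4 one of the two products in the
  recursion dominates and the coefficient is a product of earlier ones. For an index divisible by 4
  both products have the same degree. If \<open>\<psi>\<^sub>2\<^sub>r\<close> is computed with \<open>r\<close> congruent to 2
  modulo 4, the coefficients of \<open>\<phi>\<^sub>r\<^sub>+\<^sub>2\<close> and \<open>\<phi>\<^sub>r\<^sub>-\<^sub>2\<close> contribute
  \<open>(r + 2) / 2 + (r - 2) / 2 = r\<close>; if 4 divides \<open>r\<close>, the factor \<open>r / 2\<close> of
  \<open>\<phi>\<^sub>r\<close> meets two equal summands. Either way the factor is \<open>r\<close>, half of the new index.

  Since \<open>d\<close> is nonzero and the characteristic is not 2, this coefficient vanishes exactly
  when 4 and the characteristic both divide \<open>n\<close>. Multiplication by \<open>y + 1\<close> for even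
  \<open>n\<close> turns \<open>e(n)\<close> into the asserted degree, \<open>m(n)\<close> or \<open>m(n) - 1\<close>.
\<close>

section \<open>Polynomials with a prescribed top coefficient\<close>

text \<open>A degree bound together with the coefficient at the bound, which may be zero. Unlike the
  degree itself this is preserved by products and by differences with a common bound, so
  the indices at which the top coefficient vanishes need no separate treatment.\<close>
definition top_term :: "'a::comm_ring_1 poly \<Rightarrow> nat \<Rightarrow> 'a \<Rightarrow> bool" where
  "top_term p e c \<longleftrightarrow> degree p \<le> e \<and> coeff p e = c"

lemma top_term_mult:
  assumes "top_term p e b" "top_term q f c"
  shows "top_term (p * q) (e + f) (b * c)"
proof -
  have "coeff p i * coeff q (e + f - i) = (if i = e then b * c else 0)" if "i \<le> e + f" for i
    using assms that by (cases i e rule: linorder_cases) (auto simp: top_term_def coeff_eq_0)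
  then have "coeff (p * q) (e + f) = (\<Sum>i\<le>e + f. if i = e then b * c else 0)"
    unfolding coeff_mult by (intro sum.cong) auto
  also have "\<dots> = b * c" by simp
  finally show ?thesis
    using assms degree_mult_le[of p q] by (simp add: top_term_def)
qed

lemma top_term_power: "top_term p e c \<Longrightarrow> top_term (p ^ k) (k * e) (c ^ k)"
proof (induction k)
  case 0
  then show ?case by (simp add: top_term_def)
next
  case (Suc k)
  then show ?case using top_term_mult[of p e c "p ^ k" "k * e" "c ^ k"] by simp
qed

lemma top_term_diff:
  "top_term p e b \<Longrightarrow> top_term q e c \<Longrightarrow> top_term (p - q) e (b - c)"
  by (auto simp: top_term_def intro: degree_diff_le)

lemma top_term_lower: "top_term p f c \<Longrightarrow> f < e \<Longrightarrow> top_term p e 0"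
  by (auto simp: top_term_def coeff_eq_0)

lemma top_term_smult: "top_term p e c \<Longrightarrow> top_term ([:b:] * p) e (b * c)"
  by (auto simp: top_term_def intro: order.trans[OF degree_smult_le])

lemma top_term_diff_left:
  "top_term p e b \<Longrightarrow> top_term q f c \<Longrightarrow> f < e \<Longrightarrow> top_term (p - q) e b"
  using top_term_diff[of p e b q 0] top_term_lower[of q f c e] by simp

lemma top_term_diff_right:
  "top_term p e b \<Longrightarrow> top_term q f c \<Longrightarrow> e < f \<Longrightarrow> top_term (p - q) f (- c)"
  using top_term_diff[of p f 0 q c] top_term_lower[of p e b f] by simp

lemma top_term_diff':
  "top_term p e b \<Longrightarrow> top_term q f c \<Longrightarrow> e = f \<Longrightarrow> top_term (p - q) f (b - c)"
  by (simp add: top_term_diff)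

lemma top_term_cong: "top_term p e c \<Longrightarrow> e = f \<Longrightarrow> c = b \<Longrightarrow> top_term p f b" by simp

section \<open>A recursion without denominators\<close>

text \<open>After the factors \<^term>\<open>y + 1\<close> have been split off, the denominator
  \<^term>\<open>(y + 1)^2\<close> of the recursion for odd indices turns into a factor
  \<^term>\<open>(y + 1)^2\<close>: four of the terms in such a product have even index (counted
  with multiplicity), and two of the four factors cancel.\<close>
definition doubling_weight :: "'a::field \<Rightarrow> 'a \<Rightarrow> 'a poly" where
  "doubling_weight a d = 4 * [:a, 0, - d:]^2 * [:1, 1:]^2"

lemma top_term_doubling_weight: "top_term (doubling_weight a d) 6 (4 * d^2)"
proof -
  have "top_term (4 :: 'a poly) 0 4"
    by (simp add: top_term_def numeral_poly)
  moreover have "top_term ([:a, 0, - d:]^2) (2 * 2) ((- d)^2)"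
    by (intro top_term_power) (simp add: top_term_def numeral_2_eq_2)
  moreover have "top_term ([:1, 1 :: 'a:]^2) (2 * 1) (1^2)"
    by (intro top_term_power) (simp add: top_term_def)
  ultimately have "top_term (doubling_weight a d) (0 + 2 * 2 + 2 * 1) (4 * (- d)^2 * 1^2)"
    unfolding doubling_weight_def by (intro top_term_mult)
  then show ?thesis by simp
qed

text \<open>The recursion of \<^const>\<open>psi_tilde\<close>, rewritten for the quotient by \<open>y + 1\<close>
  at even indices. For even \<open>n\<close>
  no factor \<open>y + 1\<close> remains: the right-hand side contains two of them, one cancels
  against the denominator and the other against the left-hand side.\<close>
function phi :: "'a::field \<Rightarrow> 'a \<Rightarrow> nat \<Rightarrow> 'a poly" where
  "phi a d n =
    (let r = n div 2; w = doubling_weight a d in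
     if n = 0 then 0
     else if n = 1 then 1
     else if n = 2 then 1
     else if n = 3 then [:a, 2 * a, 0, - 2 * d, - d:]
     else if n = 4 then [:0, 2 * a, 0, 0, 0, - 2 * d:]
     else if odd n then
       (if r mod 4 = 0 then [:a - d:] * w * phi a d (r + 2) * phi a d r ^ 3
            - phi a d (r - 1) * phi a d (r + 1) ^ 3
        else if r mod 4 = 1 then phi a d (r + 2) * phi a d r ^ 3
            - w * phi a d (r - 1) * phi a d (r + 1) ^ 3
        else if r mod 4 = 2 then w * phi a d (r + 2) * phi a d r ^ 3
            - phi a d (r - 1) * phi a d (r + 1) ^ 3
        else phi a d (r + 2) * phi a d r ^ 3
            - [:a - d:] * w * phi a d (r - 1) * phi a d (r + 1) ^ 3)
     else
       phi a d r *
         ((if r mod 4 = 1 then [:a - d:] else 1) * phi a d (r + 2) * phi a d (r - 1) ^ 2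
           - (if r mod 4 = 3 then [:a - d:] else 1) * phi a d (r - 2) * phi a d (r + 1) ^ 2))"
  by pat_completeness (elim Pair_inject, hypsubst, rule refl)
termination
  by (relation "measure (\<lambda>(_, _, n). n)") auto

declare phi.simps [simp del]

lemma to_fract_power: "to_fract (p ^ k) = to_fract p ^ k"
  by (induction k) simp_all

lemma to_fract_numeral: "to_fract (numeral k :: 'a::idom) = numeral k"
proof -
  have "to_fract (of_nat m :: 'a) = of_nat m" for m
    by (induction m) simp_all
  from this[of "numeral k"] show ?thesis by simp
qed

lemma to_fract_pCons:
  "to_fract (pCons c p) = const_fract c + y_fract * to_fract (p :: 'a::field poly)"
proof -
  have "pCons c p = [:c:] + [:0, 1:] * p" by simp
  then show ?thesis
    unfolding const_fract_def y_fract_def by (simp del: mult_pCons_left)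
qed

lemma to_fract_smult: "to_fract (smult c p) = const_fract c * to_fract (p :: 'a::field poly)"
  by (simp add: const_fract_def flip: to_fract_mult)

text \<open>With \<open>Y = y + 1\<close>, each formula for \<^const>\<open>psi_tilde\<close> becomes one for
  \<^const>\<open>phi\<close> by counting the factors \<open>Y\<close>. For even \<open>r\<close>, the terms at
  \<open>r\<close> and \<open>r \<plusminus> 2\<close> each carry one; for odd \<open>r\<close>, the terms at
  \<open>r \<plusminus> 1\<close> do.\<close>
lemma psi_tilde_eq_phi:
  "psi_tilde a d n = (if even n then y_fract + 1 else 1) * to_fract (phi a d n)"
proof (induction n rule: less_induct)
  case (less n)
  have nz: "y_fract + (1 :: 'a poly fract) \<noteq> 0"
  proof -
    have "y_fract + (1 :: 'a poly fract) = to_fract [:1, 1:]"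
      by (simp add: y_fract_def one_pCons flip: to_fract_add to_fract_1)
    then show ?thesis by simp
  qed
  have const: "const_fract 0 = (0 :: 'a poly fract)" "const_fract 1 = (1 :: 'a poly fract)"
    "const_fract (b - c) = const_fract b - const_fract c"
    "const_fract (- b) = - const_fract b"
    "const_fract (2 * b) = 2 * const_fract b" for b c :: 'a
    by (simp_all add: const_fract_def one_pCons flip: to_fract_diff to_fract_uminus
         to_fract_numeral to_fract_mult to_fract_1)
     (simp_all add: numeral_poly flip: to_fract_mult)
  have Y: "to_fract [:1, 1:] = (y_fract + 1 :: 'a poly fract)"
    by (simp add: to_fract_pCons const)
  have C: "to_fract [:a - d:] = const_fract a - const_fract d"
    by (simp add: to_fract_pCons const)
  have "to_fract [:a, 0, - d:] = const_fract a - const_fract d * y_fract^2"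
    by (simp add: to_fract_pCons const power2_eq_square)
  then have w: "to_fract (doubling_weight a d)
      = 4 * (const_fract a - const_fract d * y_fract^2)^2 * (y_fract + 1)^2"
    by (simp add: doubling_weight_def to_fract_power to_fract_numeral Y del: One_nat_def)
  consider "n = 0" | "n = 1" | "n = 2" | "n = 3" | "n = 4" | "n \<ge> 5" by linarith
  then show ?case
  proof cases
    case 1 then show ?thesis by (simp add: psi_tilde.simps[of a d 0] phi.simps[of a d 0] Let_def)
  next
    case 2 then show ?thesis by (simp add: psi_tilde.simps[of a d 1] phi.simps[of a d 1] Let_def del: One_nat_def)
  next
    case 3 then show ?thesis by (simp add: psi_tilde.simps[of a d 2] phi.simps[of a d 2] Let_def)
  next
    case 4 then show ?thesis
      by (simp add: psi_tilde.simps[of a d 3] phi.simps[of a d 3] Let_def to_fract_pCons const)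
        (simp add: algebra_simps power4_eq_xxxx power3_eq_cube)
  next
    case 5 then show ?thesis
      by (simp add: psi_tilde.simps[of a d 4] phi.simps[of a d 4] Let_def to_fract_pCons const)
        (simp add: algebra_simps power4_eq_xxxx power3_eq_cube)
  next
    case 6
    define r where "r = n div 2"
    have r: "n div 2 = r" "r \<ge> 2" "even n \<Longrightarrow> r \<ge> 3" "r < n" "r + 1 < n" "odd n \<Longrightarrow> r + 2 < n"
       "even n \<Longrightarrow> r + 2 < n"
      using 6 by (auto simp: r_def elim!: evenE oddE)
    have IH: "psi_tilde a d j = (if even j then y_fract + 1 else 1) * to_fract (phi a d j)"
      if "j \<in> {r - 2, r - 1, r, r + 1, r + 2}" for j
      by (rule less) (use r that in auto)
    note IH = IH[of "r - 2"] IH[of "r - 1"] IH[of r] IH[of "r + 1"] IH[of "r + 2"]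
    have par: "even (r + 2) = even r" "even (r + 1) = odd r" "even (r - 1) = odd r"
      "even (r - 2) = even r"
      using r by auto
    \<comment> \<open>Opaque names, so that clearing the denominator \<^term>\<open>y + 1\<close> does not expand
      it or the squared weight.\<close>
    define P where "P j = to_fract (phi a d j)" for j
    define A where "A = const_fract a"
    define D where "D = const_fract d"
    define y where "y = (y_fract :: 'a poly fract)"
    define Y where "Y = y + 1"
    define Q where "Q = A - D * y^2"
    have y1: "Y \<noteq> 0" using nz by (simp add: Y_def y_def)
    have rmod: "r mod 4 = 0 \<and> even r \<or> r mod 4 = 1 \<and> odd r \<or> r mod 4 = 2 \<and> even r \<or> r mod 4 = 3 \<and> odd r"
      by presburger
    show ?thesis
    proof (cases "even n")
      case True
      show ?thesis
        using rmod 6 True y1 r(3)[OF True] unfolding psi_tilde.simps[of a d n] phi.simps[of a d n] Let_def r(1)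
        by (elim disjE conjE) (simp_all add: IH par to_fract_power to_fract_smult const w C
          flip: P_def A_def D_def y_def Y_def Q_def del: One_nat_def add_2_eq_Suc',
          simp_all add: power2_eq_square field_simps)
    next
      case False
      show ?thesis
        using rmod 6 False y1 r(2) unfolding psi_tilde.simps[of a d n] phi.simps[of a d n] Let_def r(1)
        by (elim disjE conjE) (simp_all add: IH par to_fract_power to_fract_smult const w C
          flip: P_def A_def D_def y_def Y_def Q_def del: One_nat_def add_2_eq_Suc',
          simp_all add: power2_eq_square power3_eq_cube field_simps)
    qed
  qed
qed

lemma phi_small:
  "phi a d 1 = 1" "phi a d 2 = 1" "phi a d 3 = [:a, 2 * a, 0, - 2 * d, - d:]"
  "phi a d 4 = [:0, 2 * a, 0, 0, 0, - 2 * d:]"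
  by (simp_all add: phi.simps[of a d 1] phi.simps[of a d 2] phi.simps[of a d 3]
      phi.simps[of a d 4] Let_def del: One_nat_def)

text \<open>The index modulo 8 decides its parity and the residue of its half modulo 4, hence
  the formula that applies. The residues 1 to 4 are represented by 9 to 12, because the
  indices below 5 are the initial values.\<close>
lemma phi_mod_8:
  "phi a d (8 * q + 5) = doubling_weight a d * phi a d (4 * q + 4) * phi a d (4 * q + 2) ^ 3
      - phi a d (4 * q + 1) * phi a d (4 * q + 3) ^ 3" (is ?R5)
  "phi a d (8 * q + 6) = phi a d (4 * q + 3) * (phi a d (4 * q + 5) * phi a d (4 * q + 2) ^ 2
      - [:a - d:] * phi a d (4 * q + 1) * phi a d (4 * q + 4) ^ 2)" (is ?R6)
  "phi a d (8 * q + 7) = phi a d (4 * q + 5) * phi a d (4 * q + 3) ^ 3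
      - [:a - d:] * doubling_weight a d * phi a d (4 * q + 2) * phi a d (4 * q + 4) ^ 3" (is ?R7)
  "phi a d (8 * q + 8) = phi a d (4 * q + 4) * (phi a d (4 * q + 6) * phi a d (4 * q + 3) ^ 2
      - phi a d (4 * q + 2) * phi a d (4 * q + 5) ^ 2)" (is ?R8)
  "phi a d (8 * q + 9) = [:a - d:] * doubling_weight a d * phi a d (4 * q + 6) * phi a d (4 * q + 4) ^ 3
      - phi a d (4 * q + 3) * phi a d (4 * q + 5) ^ 3" (is ?R9)
  "phi a d (8 * q + 10) = phi a d (4 * q + 5) * ([:a - d:] * phi a d (4 * q + 7) * phi a d (4 * q + 4) ^ 2
      - phi a d (4 * q + 3) * phi a d (4 * q + 6) ^ 2)" (is ?R10)
  "phi a d (8 * q + 11) = phi a d (4 * q + 7) * phi a d (4 * q + 5) ^ 3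
      - doubling_weight a d * phi a d (4 * q + 4) * phi a d (4 * q + 6) ^ 3" (is ?R11)
  "phi a d (8 * q + 12) = phi a d (4 * q + 6) * (phi a d (4 * q + 8) * phi a d (4 * q + 5) ^ 2
      - phi a d (4 * q + 4) * phi a d (4 * q + 7) ^ 2)" (is ?R12)
proof -
  have half: "(8 * q + 5) div 2 = 4 * q + 2" "(8 * q + 6) div 2 = 4 * q + 3"
    "(8 * q + 7) div 2 = 4 * q + 3" "(8 * q + 8) div 2 = 4 * q + 4"
    "(8 * q + 9) div 2 = 4 * q + 4" "(8 * q + 10) div 2 = 4 * q + 5"
    "(8 * q + 11) div 2 = 4 * q + 5" "(8 * q + 12) div 2 = 4 * q + 6"
    by linarith+
  have mod: "(4 * q + 2) mod 4 = 2" "(4 * q + 3) mod 4 = 3" "(4 * q + 4) mod 4 = 0"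
    "(4 * q + 5) mod 4 = 1" "(4 * q + 6) mod 4 = 2"
    by presburger+
  have idx: "4 * q + 2 - 1 = 4 * q + 1" "4 * q + 3 - 1 = 4 * q + 2" "4 * q + 4 - 1 = 4 * q + 3"
    "4 * q + 5 - 1 = 4 * q + 4" "4 * q + 6 - 1 = 4 * q + 5" "4 * q + 3 - 2 = 4 * q + 1"
    "4 * q + 4 - 2 = 4 * q + 2" "4 * q + 5 - 2 = 4 * q + 3" "4 * q + 6 - 2 = 4 * q + 4"
    by linarith+
  note expand = Let_def half mod idx add.assoc
  note [simp del] = One_nat_def add_2_eq_Suc' add_2_eq_Suc
  show ?R5 by (subst phi.simps) (simp add: expand)
  show ?R6 by (subst phi.simps) (simp add: expand)
  show ?R7 by (subst phi.simps) (simp add: expand)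
  show ?R8 by (subst phi.simps) (simp add: expand)
  show ?R9 by (subst phi.simps) (simp add: expand)
  show ?R10 by (subst phi.simps) (simp add: expand)
  show ?R11 by (subst phi.simps) (simp add: expand)
  show ?R12 by (subst phi.simps) (simp add: expand)
qed

section \<open>The top coefficient\<close>

definition phi_deg :: "nat \<Rightarrow> nat" where
  "phi_deg n = (if odd n then (n^2 - 1) div 2 else if 4 dvd n then (n^2 - 6) div 2 else (n^2 - 4) div 2)"

text \<open>The exponent \<open>(n\<^sup>2 - 1) div 8\<close> joins three exact values: it is
  \<open>(n\<^sup>2 - 1) / 8\<close> for odd \<open>n\<close>, \<open>(n\<^sup>2 - 4) / 8\<close> for
  \<open>n\<close> congruent to 2 modulo 4, and \<open>n\<^sup>2 / 8 - 1\<close> when 4 divides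
  \<open>n\<close>.\<close>
definition phi_coeff :: "'a::field \<Rightarrow> nat \<Rightarrow> 'a" where
  "phi_coeff d n = (if odd n then (- 1) ^ (n div 2)
      else (- 1) ^ (n div 4) * (if 4 dvd n then of_nat (n div 2) else 1)) * d ^ ((n^2 - 1) div 8)"

lemma phi_deg_mod_4:
  "phi_deg (4 * q + 1) = 8 * q^2 + 4 * q" (is ?T1)
  "phi_deg (4 * q + 2) = 8 * q^2 + 8 * q" (is ?T2)
  "phi_deg (4 * q + 3) = 8 * q^2 + 12 * q + 4" (is ?T3)
  "phi_deg (4 * q + 4) = 8 * q^2 + 16 * q + 5" (is ?T4)
proof -
  have "\<not> 4 dvd 4 * q + 2" by presburger
  then show ?T1 ?T2 ?T3 ?T4
    by (simp_all add: phi_deg_def power2_eq_square algebra_simps)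
qed

lemma phi_coeff_mod_4:
  "phi_coeff d (4 * q + 1) = d ^ (2 * q^2 + q)" (is ?T1)
  "phi_coeff d (4 * q + 2) = (- 1) ^ q * d ^ (2 * q^2 + 2 * q)" (is ?T2)
  "phi_coeff d (4 * q + 3) = - (d ^ (2 * q^2 + 3 * q + 1))" (is ?T3)
  "phi_coeff d (4 * q + 4) = (- 1) ^ (q + 1) * of_nat (2 * q + 2) * d ^ (2 * q^2 + 4 * q + 1)" (is ?T4)
proof -
  have "((4 * q + 1)^2 - 1) div 8 = 2 * q^2 + q" "((4 * q + 2)^2 - 1) div 8 = 2 * q^2 + 2 * q"
    "((4 * q + 3)^2 - 1) div 8 = 2 * q^2 + 3 * q + 1"
    "((4 * q + 4)^2 - 1) div 8 = 2 * q^2 + 4 * q + 1"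
    unfolding power2_eq_square by (simp_all add: algebra_simps)
  moreover have "\<not> 4 dvd 4 * q + 2" "(4 * q + 1) div 2 = 2 * q" "(4 * q + 2) div 4 = q"
    "(4 * q + 3) div 2 = Suc (2 * q)" "(4 * q + 4) div 4 = q + 1" "(4 * q + 4) div 2 = 2 * q + 2"
    by presburger+
  ultimately show ?T1 ?T2 ?T3 ?T4
    unfolding phi_coeff_def by (simp_all del: One_nat_def power_Suc)
qed

text \<open>The closed forms below use the parameter \<open>q\<close> of the recursion for both the new
  index and the indices on its right-hand side, so that an induction step compares polynomials
  in a single variable.\<close>
lemma phi_deg_mod_4':
  "phi_deg (4 * q + 5) = 8 * q^2 + 20 * q + 12"
  "phi_deg (4 * q + 6) = 8 * q^2 + 24 * q + 16"
  "phi_deg (4 * q + 7) = 8 * q^2 + 28 * q + 24"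
  "phi_deg (4 * q + 8) = 8 * q^2 + 32 * q + 29"
  using phi_deg_mod_4[of "q + 1"] by (simp_all add: power2_eq_square algebra_simps)

lemma phi_coeff_mod_4':
  "phi_coeff d (4 * q + 5) = d ^ (2 * q^2 + 5 * q + 3)" (is ?T1)
  "phi_coeff d (4 * q + 6) = (- 1) ^ (q + 1) * d ^ (2 * q^2 + 6 * q + 4)" (is ?T2)
  "phi_coeff d (4 * q + 7) = - (d ^ (2 * q^2 + 7 * q + 6))" (is ?T3)
  "phi_coeff d (4 * q + 8) = (- 1) ^ q * of_nat (2 * q + 4) * d ^ (2 * q^2 + 8 * q + 7)" (is ?T4)
proof -
  have "2 * (q + 1)^2 + (q + 1) = 2 * q^2 + 5 * q + 3"
    "2 * (q + 1)^2 + 2 * (q + 1) = 2 * q^2 + 6 * q + 4"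
    "2 * (q + 1)^2 + 3 * (q + 1) + 1 = 2 * q^2 + 7 * q + 6"
    "2 * (q + 1)^2 + 4 * (q + 1) + 1 = 2 * q^2 + 8 * q + 7"
    "4 * (q + 1) + 1 = 4 * q + 5" "4 * (q + 1) + 2 = 4 * q + 6"
    "4 * (q + 1) + 3 = 4 * q + 7" "4 * (q + 1) + 4 = 4 * q + 8"
    "2 * (q + 1) + 2 = 2 * q + 4"
    by (simp_all add: power2_eq_square algebra_simps)
  note phi_coeff_mod_4[of d "q + 1", unfolded this]
  then show ?T1 ?T2 ?T3 ?T4
    by simp_all
qed

lemma phi_deg_mod_8:
  "phi_deg (8 * q + 5) = 32 * q^2 + 40 * q + 12"
  "phi_deg (8 * q + 6) = 32 * q^2 + 48 * q + 16"
  "phi_deg (8 * q + 7) = 32 * q^2 + 56 * q + 24"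
  "phi_deg (8 * q + 8) = 32 * q^2 + 64 * q + 29"
  "phi_deg (8 * q + 9) = 32 * q^2 + 72 * q + 40"
  "phi_deg (8 * q + 10) = 32 * q^2 + 80 * q + 48"
  "phi_deg (8 * q + 11) = 32 * q^2 + 88 * q + 60"
  "phi_deg (8 * q + 12) = 32 * q^2 + 96 * q + 69"
  using phi_deg_mod_4'[of "2 * q"] phi_deg_mod_4'[of "2 * q + 1"]
  by (simp_all add: power2_eq_square algebra_simps)

lemma phi_coeff_mod_8:
  "phi_coeff d (8 * q + 5) = d ^ (8 * q^2 + 10 * q + 3)" (is ?T1)
  "phi_coeff d (8 * q + 6) = - (d ^ (8 * q^2 + 12 * q + 4))" (is ?T2)
  "phi_coeff d (8 * q + 7) = - (d ^ (8 * q^2 + 14 * q + 6))" (is ?T3)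
  "phi_coeff d (8 * q + 8) = of_nat (4 * q + 4) * d ^ (8 * q^2 + 16 * q + 7)" (is ?T4)
  "phi_coeff d (8 * q + 9) = d ^ (8 * q^2 + 18 * q + 10)" (is ?T5)
  "phi_coeff d (8 * q + 10) = d ^ (8 * q^2 + 20 * q + 12)" (is ?T6)
  "phi_coeff d (8 * q + 11) = - (d ^ (8 * q^2 + 22 * q + 15))" (is ?T7)
  "phi_coeff d (8 * q + 12) = - of_nat (4 * q + 6) * d ^ (8 * q^2 + 24 * q + 17)" (is ?T8)
proof -
  have "4 * (2 * q + 1) + k = 8 * q + (4 + k)" "4 * (2 * q) + k = 8 * q + k" for k by simp_all
  moreover have "2 * (2 * q + 1)^2 + 5 * (2 * q + 1) + 3 = 8 * q^2 + 18 * q + 10"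
    "2 * (2 * q + 1)^2 + 6 * (2 * q + 1) + 4 = 8 * q^2 + 20 * q + 12"
    "2 * (2 * q + 1)^2 + 7 * (2 * q + 1) + 6 = 8 * q^2 + 22 * q + 15"
    "2 * (2 * q + 1)^2 + 8 * (2 * q + 1) + 7 = 8 * q^2 + 24 * q + 17"
    "2 * (2 * q + 1) + 4 = 4 * q + 6"
    "2 * (2 * q)^2 + 5 * (2 * q) + 3 = 8 * q^2 + 10 * q + 3"
    "2 * (2 * q)^2 + 6 * (2 * q) + 4 = 8 * q^2 + 12 * q + 4"
    "2 * (2 * q)^2 + 7 * (2 * q) + 6 = 8 * q^2 + 14 * q + 6"
    "2 * (2 * q)^2 + 8 * (2 * q) + 7 = 8 * q^2 + 16 * q + 7"
    "2 * (2 * q) + 4 = 4 * q + 4"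
    by (simp_all add: power2_eq_square algebra_simps)
  ultimately show ?T1 ?T2 ?T3 ?T4 ?T5 ?T6 ?T7 ?T8
    using phi_coeff_mod_4'[of d "2 * q"] phi_coeff_mod_4'[of d "2 * q + 1"]
    by (simp_all add: algebra_simps)
qed

text \<open>For an index \<open>n\<close> not divisible by 4 the degrees of the two products differ, since each
  index divisible by 4 on the right-hand side costs a degree. The factors that involve
  \<^term>\<open>a\<close> all belong to the product of lower degree, so the coefficient depends on
  \<^term>\<open>d\<close> alone. For \<open>n\<close> divisible by 4 the degrees agree, and the signs make
  the two coefficients add up.\<close>
lemma phi_top_term:
  assumes "n \<ge> 1"
  shows "top_term (phi a d n) (phi_deg n) (phi_coeff d n)"
  using assms
proof (induction n rule: less_induct)
  case (less n)
  note w = top_term_doubling_weight[of a d]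
  note M = top_term_mult and P = top_term_power and S = top_term_smult
  \<comment> \<open>Below these rules are composed along the shape of each
    recursion formula; L, R and B record which term of a recursion decides the top coefficient:
    the left one, the right one, or both.\<close>
  note L = top_term_diff_left and R = top_term_diff_right and B = top_term_diff'
  note deg = phi_deg_mod_4 phi_deg_mod_4' phi_deg_mod_8
  note coeff = phi_coeff_mod_4 phi_coeff_mod_4' phi_coeff_mod_8
  have T: "top_term (phi a d (4 * q + i)) (phi_deg (4 * q + i)) (phi_coeff d (4 * q + i))"
    if "4 * q + i < n" "0 < i" for q i
    by (rule less.IH) (use that in auto)
  \<comment> \<open>Splits the powers of \<^term>\<open>d\<close> in the closed forms into powers of
    \<^term>\<open>d ^ q\<^sup>2\<close> and \<^term>\<open>d ^ q\<close>, so that equal coefficients become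
    equal monomials.\<close>
  have exp: "d ^ (numeral k * m) = (d ^ m) ^ numeral k" for k m
    by (simp add: mult.commute flip: power_mult)
  have "n \<in> {1, 2, 3, 4} \<or> (\<exists>q. n = 8 * q + 5 \<or> n = 8 * q + 6 \<or> n = 8 * q + 7 \<or> n = 8 * q + 8
     \<or> n = 8 * q + 9 \<or> n = 8 * q + 10 \<or> n = 8 * q + 11 \<or> n = 8 * q + 12)"
    using less.prems by simp presburger
  then consider "n \<in> {1, 2, 3, 4}" | q where "n = 8 * q + 5" | q where "n = 8 * q + 6"
    | q where "n = 8 * q + 7" | q where "n = 8 * q + 8" | q where "n = 8 * q + 9"
    | q where "n = 8 * q + 10" | q where "n = 8 * q + 11" | q where "n = 8 * q + 12"
    by metis
  then show ?case
  proof cases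
    case 1
    have vals: "phi_deg 1 = 0" "phi_deg 2 = 0" "phi_deg 3 = 4" "phi_deg 4 = 5"
      "phi_coeff d 1 = 1" "phi_coeff d 2 = 1" "phi_coeff d 3 = - d" "phi_coeff d 4 = - 2 * d"
      using phi_deg_mod_4[of 0] phi_coeff_mod_4[of d 0] by (simp_all add: numeral_2_eq_2)
    have "top_term (phi a d 1) 0 1" "top_term (phi a d 2) 0 1"
      by (simp_all add: phi_small top_term_def del: One_nat_def)
    moreover have "top_term (phi a d 3) 4 (- d)" "top_term (phi a d 4) 5 (- 2 * d)"
      unfolding phi_small top_term_def by (simp_all add: eval_nat_numeral)
    ultimately show ?thesis
      using 1 by (auto simp: vals simp del: One_nat_def)
  next
    case q: 2
    show ?thesis
      unfolding q phi_mod_8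
      by (rule top_term_cong[OF R[OF M[OF M[OF w T] P[OF T]] M[OF T P[OF T]]]])
        (simp_all only: q deg coeff,
         simp_all add: power_add exp,
         (cases "even q"; simp add: eval_nat_numeral algebra_simps))
  next
    case q: 3
    show ?thesis
      unfolding q phi_mod_8
      by (rule top_term_cong[OF M[OF T L[OF M[OF T P[OF T]] M[OF S[OF T] P[OF T]]]]])
        (simp_all only: q deg coeff,
         simp_all add: power_add exp,
         (cases "even q"; simp add: eval_nat_numeral algebra_simps))
  next
    case q: 4
    show ?thesis
      unfolding q phi_mod_8
      by (rule top_term_cong[OF L[OF M[OF T P[OF T]] M[OF M[OF S[OF w] T] P[OF T]]]])
        (simp_all only: q deg coeff,
         simp_all add: power_add exp,
         (cases "even q"; simp add: eval_nat_numeral algebra_simps))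
  next
    case q: 5
    show ?thesis
      unfolding q phi_mod_8
      by (rule top_term_cong[OF M[OF T B[OF M[OF T P[OF T]] M[OF T P[OF T]]]]])
        (simp_all only: q deg coeff,
         simp_all add: power_add exp,
         (cases "even q"; simp add: eval_nat_numeral algebra_simps))
  next
    case q: 6
    show ?thesis
      unfolding q phi_mod_8
      by (rule top_term_cong[OF R[OF M[OF M[OF S[OF w] T] P[OF T]] M[OF T P[OF T]]]])
        (simp_all only: q deg coeff,
         simp_all add: power_add exp,
         (cases "even q"; simp add: eval_nat_numeral algebra_simps))
  next
    case q: 7
    show ?thesis
      unfolding q phi_mod_8
      by (rule top_term_cong[OF M[OF T R[OF M[OF S[OF T] P[OF T]] M[OF T P[OF T]]]]])
        (simp_all only: q deg coeff,
         simp_all add: power_add exp,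
         (cases "even q"; simp add: eval_nat_numeral algebra_simps))
  next
    case q: 8
    show ?thesis
      unfolding q phi_mod_8
      by (rule top_term_cong[OF L[OF M[OF T P[OF T]] M[OF M[OF w T] P[OF T]]]])
        (simp_all only: q deg coeff,
         simp_all add: power_add exp,
         (cases "even q"; simp add: eval_nat_numeral algebra_simps))
  next
    case q: 9
    show ?thesis
      unfolding q phi_mod_8
      by (rule top_term_cong[OF M[OF T B[OF M[OF T P[OF T]] M[OF T P[OF T]]]]])
        (simp_all only: q deg coeff,
         simp_all add: power_add exp,
         (cases "even q"; simp add: eval_nat_numeral algebra_simps))
  qed
qed
section \<open>The degree\<close>

lemma m_deg_eq:
  assumes "n \<ge> 1"
  shows "odd n \<Longrightarrow> m_deg n = phi_deg n"
    and "even n \<Longrightarrow> \<not> 4 dvd n \<Longrightarrow> m_deg n = phi_deg n + 1"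
    and "4 dvd n \<Longrightarrow> m_deg n - 1 = phi_deg n + 1"
proof -
  show "odd n \<Longrightarrow> m_deg n = phi_deg n"
    by (simp add: m_deg_def phi_deg_def)
  show "m_deg n = phi_deg n + 1" if "even n" "\<not> 4 dvd n"
  proof -
    have "n = 4 * (n div 4) + 2"
      using that by presburger
    then obtain q where q: "n = 4 * q + 2" ..
    show ?thesis
      unfolding q phi_deg_mod_4 by (simp add: m_deg_def power2_eq_square algebra_simps)
  qed
  show "m_deg n - 1 = phi_deg n + 1" if "4 dvd n"
  proof -
    have "n = 4 * (n div 4 - 1) + 4"
      using that assms by presburger
    then obtain q where q: "n = 4 * q + 4" ..
    show ?thesis
      unfolding q phi_deg_mod_4 by (simp add: m_deg_def power2_eq_square algebra_simps)
  qed
qed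

text \<open>Powers of \<^term>\<open>d\<close> and signs are nonzero, so only the factor \<open>n / 2\<close>
  can vanish, and in characteristic other than 2 it vanishes together with \<open>n\<close>.\<close>
lemma phi_coeff_eq_0_iff:
  fixes d :: "'a::field"
  assumes "CHAR('a) \<noteq> 2" "d \<noteq> 0"
  shows "phi_coeff d n = 0 \<longleftrightarrow> 4 dvd n \<and> CHAR('a) dvd n"
proof -
  have "\<not> CHAR('a) dvd 2"
    using assms(1) CHAR_not_1' prime_nat_iff[of 2] by auto
  then have two: "(of_nat 2 :: 'a) \<noteq> 0"
    by (simp only: of_nat_eq_0_iff_char_dvd not_False_eq_True)
  have "(of_nat (n div 2) :: 'a) = 0 \<longleftrightarrow> CHAR('a) dvd n" if "4 dvd n"
  proof -
    have "n = 2 * (n div 2)"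
      using that by presburger
    then have "(of_nat n :: 'a) = of_nat 2 * of_nat (n div 2)"
      by (metis of_nat_mult)
    then show ?thesis
      using two by (metis mult_eq_0_iff of_nat_eq_0_iff_char_dvd)
  qed
  moreover have "even n" if "4 dvd n"
    using that by presburger
  ultimately show ?thesis
    using assms(2) by (auto simp: phi_coeff_def)
qed

theorem corollary7p3:
  fixes a d :: "'a::field" and n :: nat
  assumes "CHAR('a) \<noteq> 2" and "CHAR('a) \<noteq> 3"
    and "a \<noteq> d" and "a \<noteq> 0" and "d \<noteq> 0"
    and "n \<ge> 1"
  shows "\<exists>p :: 'a poly. to_fract p = psi_tilde a d n \<and>
    (\<not> 4 dvd n \<longrightarrow> degree p = m_deg n) \<and>
    (4 dvd n \<and> \<not> CHAR('a) dvd n \<longrightarrow> degree p = m_deg n - 1) \<and>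
    (4 dvd n \<and> CHAR('a) dvd n \<longrightarrow> degree p < m_deg n - 1)"
proof -
  define p where "p = (if even n then [:1, 1:] else 1) * phi a d n"
  define e where "e = phi_deg n + (if even n then 1 else 0)"
  have psi: "to_fract p = psi_tilde a d n"
    unfolding p_def psi_tilde_eq_phi
    by (simp add: to_fract_pCons del: mult_pCons_left) (simp add: const_fract_def flip: one_pCons)
  have phi: "top_term (phi a d n) (phi_deg n) (phi_coeff d n)"
    using assms(6) by (rule phi_top_term)
  have "top_term [:1, 1 :: 'a:] 1 1"
    by (simp add: top_term_def)
  from top_term_mult[OF this phi] have top: "top_term p e (phi_coeff d n)"
    using phi by (auto simp: p_def e_def simp del: mult_pCons_left)
  have zero: "phi_coeff d n = 0 \<longleftrightarrow> 4 dvd n \<and> CHAR('a) dvd n"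
    using assms(1,5) by (rule phi_coeff_eq_0_iff)
  have deg_eq: "degree p = e" if "phi_coeff d n \<noteq> 0"
    using top that by (metis le_antisym le_degree top_term_def)
  have deg_less: "degree p < e" if "phi_coeff d n = 0" "e > 0"
    using top that by (metis degree_0 leading_coeff_0_iff le_neq_implies_less top_term_def)
  have e1: "e = m_deg n" if "\<not> 4 dvd n"
    using m_deg_eq(1,2)[OF assms(6)] that by (simp add: e_def)
  have e2: "e = m_deg n - 1" "e > 0" if "4 dvd n"
  proof -
    have "even n"
      using that by presburger
    then show "e = m_deg n - 1" "e > 0"
      using m_deg_eq(3)[OF assms(6) that] by (simp_all add: e_def)
  qed
  show ?thesis
    using psi zero deg_eq deg_less e1 e2 by (intro exI[of _ p]) auto
qed

end
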